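(* Let $(T_n,\rho_n)$ satisfy $T_n\to\infty$, $\rho_n\to0$ and $\rho_n^{-1}=o(n^2)$ as $n\to\infty$, and let $P_{1,n}=P_1(n,T_n,\rho_n)$, $P_{0,n}=P_0(n,T_n,\rho_n)$. Given $\mathbf A$, let $$(\hat{\boldsymbol\sigma}_{\rm mle},\hat{\boldsymbol\tau}_{\rm mle})=\arg\max_{\boldsymbol\sigma\in\mathcal S_n,\ \boldsymbol\tau\in\mathcal S_{T_n}}\ \sum_{(i,j,t):\ 2\mid\sigma(i)+\sigma(j)+\tau(t)}A_t(i,j),$$ where the sum is over $1\le i<j\le n$ and $t\in[T_n]$. If $nT_n\rho_n\to\infty$, then for any $\epsilon>0$, $$\lim_{n\to\infty}P_{1,n}\big(\ell_n(\hat{\boldsymbol\sigma}_{\rm mle},\boldsymbol\sigma)\ge\epsilon\big)=0.$$ In other words, $P_{1,n}$ is (asymptotically) recoverable, and hence distinguishable from $P_{0,n}$.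
   Context: Throughout, $n$ and $T$ are even positive integers, $[m]=\{1,\dots,m\}$, and for even $m$, $\mathcal S_m=\{\boldsymbol\sigma\in\{0,1\}^m:\sum_{i\in[m]}\sigma(i)=m/2\}$. For $\rho\in(0,2/3)$ let $B^{(0)}$ and $B^{(1)}$ be the symmetric $2\times 2$ matrices with rows and columns indexed by $\{0,1\}$: $B^{(0)}$ has diagonal entries $\frac32\rho$ and off-diagonal entries $\frac12\rho$; $B^{(1)}$ has diagonal entries $\frac12\rho$ and off-diagonal entries $\frac32\rho$. Model $P_1(n,T,\rho)$: the joint law of $(\mathbf A,\boldsymbol\sigma,\boldsymbol\tau)$ where $\boldsymbol\sigma\sim\mathrm{Uniform}(\mathcal S_n)$ and $\boldsymbol\tau\sim\mathrm{Uniform}(\mathcal S_T)$ are independent and, given $(\boldsymbol\sigma,\boldsymbol\tau)$, the entries $A_t(i,j)$, $1\le i<j\le n$, $t\in[T]$, of $\mathbf A$ are independent with $A_t(i,j)\sim\mathrm{Bernoulli}(B^{(\tau(t))}(\sigma(i),\sigma(j)))$. Model $P_0(n,T,\rho)$: the $A_t(i,j)$ are i.i.d. $\mathrm{Bernoulli}(\rho)$. Only $\mathbf A$ is observed. $\ell_n(\hat{\boldsymbol\sigma},\boldsymbol\sigma)=n^{-1}\min\{d_{\rm Ham}(\hat{\boldsymbol\sigma},\boldsymbol\sigma),d_{\rm Ham}(\hat{\boldsymbol\sigma},1-\boldsymbol\sigma)\}$, where $d_{\rm Ham}$ is the Hamming distance. Recoverable: there is a sequence of estimators $\hat{\boldsymbol\sigma}(\mathbf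 A)\in\mathcal S_n$ such that $P_{1,n}(\ell_n(\hat{\boldsymbol\sigma},\boldsymbol\sigma)\ge\epsilon)\to0$ for every constant $\epsilon>0$. Distinguishable: there is a sequence of tests $\hat\psi(\mathbf A)\in\{0,1\}$ with $P_{1,n}(\hat\psi(\mathbf A)=0)+P_{0,n}(\hat\psi(\mathbf A)=1)\to0$. The $\arg\max$ denotes any maximizer. *)

theory Defs
  imports "HOL-Probability.Probability" "HOL-Probability.Product_PMF" "HOL-Library.Landau_Symbols"
begin

text \<open>Labellings are functions into $\{0,1\}$ on the index set $\{1,\dots,m\}$, extended by
  \<open>undefined\<close>, so that each element of $\{0,1\}^m$ is represented exactly once.\<close>

definition balanced :: "nat \<Rightarrow> (nat \<Rightarrow> nat) set" where
  "balanced m = {\<sigma> \<in> {1..m} \<rightarrow>\<^sub>E {0, 1}. real (\<Sum>i\<in>{1..m}. \<sigma> i) = real m / 2}"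

lemma finite_balanced: "finite (balanced m)"
proof (rule finite_subset)
  show "balanced m \<subseteq> {1..m} \<rightarrow>\<^sub>E {0, 1}" by (auto simp: balanced_def)
  show "finite (({1..m} \<rightarrow>\<^sub>E {0, 1}) :: (nat \<Rightarrow> nat) set)" by (rule finite_PiE) auto
qed

lemma balanced_nonempty:
  assumes "even m"
  shows "balanced m \<noteq> {}"
proof -
  define \<sigma> :: "nat \<Rightarrow> nat" where
    "\<sigma> = restrict (\<lambda>i. if i \<le> m div 2 then 1 else 0) {1..m}"
  have "(\<Sum>i\<in>{1..m}. \<sigma> i) = (\<Sum>i\<in>{1..m}. if i \<le> m div 2 then 1 else 0)"
    by (rule sum.cong) (auto simp: \<sigma>_def)
  also have "\<dots> = card {i \<in> {1..m}. i \<le> m div 2}"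
    by (simp add: sum.If_cases Int_def)
  also have "{i \<in> {1..m}. i \<le> m div 2} = {1..m div 2}" by auto
  finally have "real (\<Sum>i\<in>{1..m}. \<sigma> i) = real m / 2"
    using assms by (auto elim!: evenE)
  moreover have "\<sigma> \<in> {1..m} \<rightarrow>\<^sub>E {0, 1}" by (auto simp: \<sigma>_def)
  ultimately show ?thesis unfolding balanced_def by blast
qed

type_synonym obs = "nat \<times> nat \<times> nat \<Rightarrow> bool"

text \<open>An observation \<open>A\<close> stores $A_t(i,j)$ as \<open>A (i, j, t)\<close>; entries outside the index set are
  fixed to \<open>False\<close>.\<close>

definition entries :: "nat \<Rightarrow> nat \<Rightarrow> (nat \<times> nat \<times> nat) set" where
  "entries n T = {(i, j, t). 1 \<le> i \<and> i < j \<and> j \<le> n \<and> t \<in> {1..T}}"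

lemma finite_entries: "finite (entries n T)"
  by (rule finite_subset[of _ "{1..n} \<times> {1..n} \<times> {1..T}"]) (auto simp: entries_def)

definition observations :: "nat \<Rightarrow> nat \<Rightarrow> obs set" where
  "observations n T = PiE_dflt (entries n T) False (\<lambda>_. UNIV)"

definition B :: "real \<Rightarrow> nat \<Rightarrow> nat \<Rightarrow> nat \<Rightarrow> real" where
  "B \<rho> s a b =
     (if s = 0 then (if a = b then 3/2 * \<rho> else 1/2 * \<rho>)
      else (if a = b then 1/2 * \<rho> else 3/2 * \<rho>))"

definition P1 :: "nat \<Rightarrow> nat \<Rightarrow> real \<Rightarrow> (obs \<times> (nat \<Rightarrow> nat) \<times> (nat \<Rightarrow> nat)) pmf" where
  "P1 n T \<rho> =
     do {
       \<sigma> \<leftarrow> pmf_of_set (balanced n);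
       \<tau> \<leftarrow> pmf_of_set (balanced T);
       A \<leftarrow> Pi_pmf (entries n T) False (\<lambda>(i, j, t). bernoulli_pmf (B \<rho> (\<tau> t) (\<sigma> i) (\<sigma> j)));
       return_pmf (A, \<sigma>, \<tau>)
     }"

definition P0 :: "nat \<Rightarrow> nat \<Rightarrow> real \<Rightarrow> obs pmf" where
  "P0 n T \<rho> = Pi_pmf (entries n T) False (\<lambda>_. bernoulli_pmf \<rho>)"

definition hamming :: "nat \<Rightarrow> (nat \<Rightarrow> nat) \<Rightarrow> (nat \<Rightarrow> nat) \<Rightarrow> nat" where
  "hamming n x y = card {i \<in> {1..n}. x i \<noteq> y i}"

definition loss :: "nat \<Rightarrow> (nat \<Rightarrow> nat) \<Rightarrow> (nat \<Rightarrow> nat) \<Rightarrow> real" where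
  "loss n \<sigma>' \<sigma> = real (min (hamming n \<sigma>' \<sigma>) (hamming n \<sigma>' (\<lambda>i. 1 - \<sigma> i))) / real n"

text \<open>The parameter $n$ only ranges over the even positive integers, so all limits
  $n \to \infty$ are taken along even $n$. Sequences are total functions on \<open>nat\<close> whose values at
  odd $n$ and at $0$ play no role.\<close>

definition even_at_top :: "nat filter" where
  "even_at_top = inf at_top (principal {n. even n})"

definition mle_objective :: "nat \<Rightarrow> nat \<Rightarrow> obs \<Rightarrow> (nat \<Rightarrow> nat) \<times> (nat \<Rightarrow> nat) \<Rightarrow> nat" where
  "mle_objective n T A = (\<lambda>(\<sigma>, \<tau>).
     \<Sum>(i, j, t) \<in> {(i, j, t) \<in> entries n T. 2 dvd \<sigma> i + \<sigma> j + \<tau> t}. of_bool (A (i, j, t)))"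

text \<open>Ties may be broken arbitrarily: any function of the observation that always returns a
  maximizer qualifies.\<close>

definition is_mle :: "nat \<Rightarrow> nat \<Rightarrow> (obs \<Rightarrow> (nat \<Rightarrow> nat) \<times> (nat \<Rightarrow> nat)) \<Rightarrow> bool" where
  "is_mle n T est \<longleftrightarrow>
     (\<forall>A \<in> observations n T.
        is_arg_max (mle_objective n T A) (\<lambda>x. x \<in> balanced n \<times> balanced T) (est A))"

definition consistent ::
    "(nat \<Rightarrow> nat) \<Rightarrow> (nat \<Rightarrow> real) \<Rightarrow> (nat \<Rightarrow> obs \<Rightarrow> (nat \<Rightarrow> nat)) \<Rightarrow> bool" where
  "consistent T \<rho> est \<longleftrightarrow>
     (\<forall>\<epsilon>>0. ((\<lambda>n. measure_pmf.prob (P1 n (T n) (\<rho> n)) {(A, \<sigma>, \<tau>). loss n (est n A) \<sigma> \<ge> \<epsilon>})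
        \<longlongrightarrow> 0) even_at_top)"

definition recoverable :: "(nat \<Rightarrow> nat) \<Rightarrow> (nat \<Rightarrow> real) \<Rightarrow> bool" where
  "recoverable T \<rho> \<longleftrightarrow>
     (\<exists>est. (\<forall>n>0. even n \<longrightarrow> (\<forall>A \<in> observations n (T n). est n A \<in> balanced n)) \<and>
        consistent T \<rho> est)"

definition distinguishable :: "(nat \<Rightarrow> nat) \<Rightarrow> (nat \<Rightarrow> real) \<Rightarrow> bool" where
  "distinguishable T \<rho> \<longleftrightarrow>
     (\<exists>\<psi> :: nat \<Rightarrow> obs \<Rightarrow> nat.
        (\<forall>n>0. even n \<longrightarrow> (\<forall>A \<in> observations n (T n). \<psi> n A \<in> {0, 1})) \<and>
        ((\<lambda>n. measure_pmf.prob (P1 n (T n) (\<rho> n)) {(A, \<sigma>, \<tau>). \<psi> n A = 0}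
            + measure_pmf.prob (P0 n (T n) (\<rho> n)) {A. \<psi> n A = 1}) \<longlongrightarrow> 0) even_at_top)"

end

theory Submission
  imports Defs
begin

text \<open>Coding labels as signs $x_i = (-1)^{\sigma(i)}$, $y_t = (-1)^{\tau(t)}$, the entry
  $A_t(i,j)$ has mean $\rho(1 + x_i x_j y_t / 2)$ under $P_1$, and the likelihood objective is
  $\sum A_t(i,j)(1 + x_i x_j y_t)/2$. For a competitor $(x', y')$, balancedness of $y$ and $y'$
  removes the constant term, so the objective gap has mean and variance proxy of order $\rho D$,
  where $D = \sum (1 - x_i x_j y_t x'_i x'_j y'_t)$. This sum factorises, and $D \ge \epsilon T n^2$ as
  soon as the loss of the competitor is at least $\epsilon \le 1/4$, whatever $y'$ is. A Chernoff bound
  and a union bound over $2^{n+T}$ competitors finish the proof, since $n T \rho \to \infty$ and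
  $n^2 \rho \to \infty$ make $\rho T n^2$ dominate both $n$ and $T$. The same two bounds show that
  thresholding the maximum of $\sum A_t(i,j) x_i x_j y_t$ halfway between its typical value under $P_1$
  and $0$ tests $P_1$ against $P_0$.\<close>

section \<open>Exponential moments and tail bounds for Bernoulli arrays\<close>

lemma exp_le_quadratic:
  fixes x :: real
  assumes "\<bar>x\<bar> \<le> 1"
  shows "exp x \<le> 1 + x + x\<^sup>2"
proof (cases "x \<ge> 0")
  case True
  then show ?thesis using assms exp_bound[of x] by simp
next
  case False
  define y where "y = - x"
  have y: "0 \<le> y" using False by (simp add: y_def)
  \<comment> \<open>For negative arguments the claim is a bound on a reciprocal:
    \<open>1 - y + y\<^sup>2\<close> dominates \<open>1 / (1 + y + y\<^sup>2 / 2)\<close>, hence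
    also \<open>exp (- y)\<close>.\<close>
  have "1 \<le> (1 + y + y\<^sup>2 / 2) * (1 - y + y\<^sup>2)"
  proof -
    have "(1 + y + y\<^sup>2 / 2) * (1 - y + y\<^sup>2) = 1 + (y\<^sup>2 / 2 + y^3 / 2 + y^4 / 2)"
      by (simp add: field_simps power2_eq_square power3_eq_cube power4_eq_xxxx)
    then show ?thesis using y by simp
  qed
  also have "\<dots> \<le> exp y * (1 - y + y\<^sup>2)"
  proof (rule mult_right_mono)
    show "1 + y + y\<^sup>2 / 2 \<le> exp y" using y by (rule exp_lower_Taylor_quadratic)
    have "1 - y + y\<^sup>2 = (y - 1/2)\<^sup>2 + 3/4" by (simp add: power2_eq_square field_simps)
    then show "0 \<le> 1 - y + y\<^sup>2" by simp
  qed
  finally have "exp (- y) \<le> 1 - y + y\<^sup>2" by (simp add: exp_minus field_simps)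
  then show ?thesis by (simp add: y_def)
qed

text \<open>Markov's inequality for the exponential of \<open>l\<close> times the weighted sum;
  independence turns its mean into a product of factors
  \<open>1 + p e * (exp (l * w e) - 1)\<close>. The bounds on \<open>l\<close> and \<open>w\<close>
  keep \<open>l * w e\<close> in the range of \<open>exp_le_quadratic\<close>. The weighted mean and
  the variance proxy stay separate, so that each application can balance them through
  \<open>l\<close>.\<close>

lemma Pi_bernoulli_Chernoff:
  fixes p w :: "'a \<Rightarrow> real"
  assumes "finite E"
    and p: "\<And>e. e \<in> E \<Longrightarrow> 0 \<le> p e \<and> p e \<le> 1"
    and w: "\<And>e. e \<in> E \<Longrightarrow> \<bar>w e\<bar> \<le> 1"
    and l: "0 \<le> l" "l \<le> 1"
  shows "measure_pmf.prob (Pi_pmf E False (\<lambda>e. bernoulli_pmf (p e)))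
           {A. s \<le> (\<Sum>e\<in>E. w e * of_bool (A e))}
         \<le> exp (l * (\<Sum>e\<in>E. p e * w e) + l\<^sup>2 * (\<Sum>e\<in>E. p e * (w e)\<^sup>2) - l * s)"
proof -
  let ?M = "Pi_pmf E False (\<lambda>e. bernoulli_pmf (p e))"
  let ?X = "\<lambda>A. \<Sum>e\<in>E. w e * of_bool (A e)"
  define u where "u A = (\<Prod>e\<in>E. exp (l * w e * of_bool (A e)))" for A
  have u: "u A = exp (l * ?X A)" for A
    by (simp only: u_def exp_sum[OF \<open>finite E\<close>] sum_distrib_left mult.assoc)
  have "finite (set_pmf ?M)"
    using \<open>finite E\<close> by (simp add: set_Pi_pmf finite_PiE_dflt)
  then have int: "integrable ?M u" by (rule integrable_measure_pmf_finite)
  have "measure_pmf.prob ?M {A. s \<le> ?X A} \<le> measure_pmf.prob ?M {A. exp (l * s) \<le> u A}"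
    using l by (intro measure_pmf.finite_measure_mono) (auto simp: u mult_left_mono)
  also have "\<dots> \<le> measure_pmf.expectation ?M u / exp (l * s)"
    using integral_Markov_inequality_measure[OF int, of UNIV "exp (l * s)"]
    by (simp add: u[abs_def])
  also have "measure_pmf.expectation ?M u
      = (\<Prod>e\<in>E. measure_pmf.expectation (bernoulli_pmf (p e)) (\<lambda>b. exp (l * w e * of_bool b)))"
    unfolding u_def using \<open>finite E\<close>
    by (intro expectation_prod_Pi_pmf) (auto intro: integrable_measure_pmf_finite)
  also have "\<dots> \<le> (\<Prod>e\<in>E. exp (p e * (l * w e + (l * w e)\<^sup>2)))"
  proof (rule prod_mono)
    fix e assume e: "e \<in> E"
    have "\<bar>l * w e\<bar> \<le> 1" using w[OF e] l by (simp add: abs_mult mult_le_one)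
    then have q: "exp (l * w e) \<le> 1 + (l * w e + (l * w e)\<^sup>2)"
      using exp_le_quadratic by fastforce
    have "measure_pmf.expectation (bernoulli_pmf (p e)) (\<lambda>b. exp (l * w e * of_bool b))
        = p e * exp (l * w e) + (1 - p e)"
      using p[OF e] by simp
    also have "\<dots> \<le> p e * (1 + (l * w e + (l * w e)\<^sup>2)) + (1 - p e)"
      using p[OF e] q by (intro add_right_mono mult_left_mono) auto
    also have "\<dots> = 1 + p e * (l * w e + (l * w e)\<^sup>2)" by (simp add: algebra_simps)
    also have "\<dots> \<le> exp (p e * (l * w e + (l * w e)\<^sup>2))" by (rule exp_ge_add_one_self)
    finally show "0 \<le> measure_pmf.expectation (bernoulli_pmf (p e)) (\<lambda>b. exp (l * w e * of_bool b)) \<and>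
        measure_pmf.expectation (bernoulli_pmf (p e)) (\<lambda>b. exp (l * w e * of_bool b))
        \<le> exp (p e * (l * w e + (l * w e)\<^sup>2))"
      by simp
  qed
  also have "\<dots> = exp (l * (\<Sum>e\<in>E. p e * w e) + l\<^sup>2 * (\<Sum>e\<in>E. p e * (w e)\<^sup>2))"
    using \<open>finite E\<close>
    by (simp add: exp_sum[symmetric] sum_distrib_left sum.distrib[symmetric] power_mult_distrib algebra_simps)
  finally show ?thesis
    by (simp add: exp_diff divide_right_mono)
qed

lemma prob_bind_pmf_le:
  assumes "\<And>x. x \<in> set_pmf M \<Longrightarrow> measure_pmf.prob (f x) S \<le> c"
  shows "measure_pmf.prob (bind_pmf M f) S \<le> c"
proof -
  \<comment> \<open>A point of the support gives \<open>0 \<le> c\<close>, which the passage through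
    \<open>ennreal c\<close> requires.\<close>
  obtain x where "x \<in> set_pmf M" using set_pmf_not_empty[of M] by blast
  then have c: "0 \<le> c" using assms measure_nonneg order_trans by blast
  have "emeasure (bind_pmf M f) S = (\<integral>\<^sup>+x. emeasure (f x) S \<partial>M)" by simp
  also have "\<dots> \<le> (\<integral>\<^sup>+x. ennreal c \<partial>M)"
    using assms by (intro nn_integral_mono_AE)
      (auto simp: AE_measure_pmf_iff measure_pmf.emeasure_eq_measure intro: ennreal_leI)
  also have "\<dots> = ennreal c" by (simp add: measure_pmf.emeasure_space_1[simplified])
  finally show ?thesis using c by (simp add: measure_pmf.emeasure_eq_measure)
qed

lemma prob_UN_le_card:
  assumes "finite I" and "\<And>i. i \<in> I \<Longrightarrow> measure_pmf.prob M (F i) \<le> c"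
  shows "measure_pmf.prob M (\<Union>i\<in>I. F i) \<le> real (card I) * c"
proof -
  have "measure_pmf.prob M (\<Union>i\<in>I. F i) \<le> (\<Sum>i\<in>I. measure_pmf.prob M (F i))"
    using assms(1) by (intro measure_UNION_le) auto
  also have "\<dots> \<le> real (card I) * c" using assms(2) by (rule sum_bounded_above)
  finally show ?thesis .
qed

section \<open>Balanced labellings and sums over the entries\<close>

lemma card_balanced_le: "card (balanced m) \<le> 2 ^ m"
proof -
  have "card (balanced m) \<le> card ({1..m} \<rightarrow>\<^sub>E {0, 1::nat})"
    by (rule card_mono) (auto simp: balanced_def intro!: finite_PiE)
  then show ?thesis by (simp add: card_PiE numeral_2_eq_2)
qed

lemma balanced_range: "\<sigma> \<in> balanced m \<Longrightarrow> i \<in> {1..m} \<Longrightarrow> \<sigma> i = 0 \<or> \<sigma> i = 1"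
  by (auto simp: balanced_def PiE_def Pi_def)

lemma sum_sign_balanced:
  assumes "\<sigma> \<in> balanced m"
  shows "(\<Sum>i\<in>{1..m}. (-1::real) ^ \<sigma> i) = 0"
proof -
  have "(\<Sum>i\<in>{1..m}. (-1::real) ^ \<sigma> i) = (\<Sum>i\<in>{1..m}. 1 - 2 * real (\<sigma> i))"
    using balanced_range[OF assms] by (intro sum.cong) force+
  also have "\<dots> = real m - 2 * real (\<Sum>i\<in>{1..m}. \<sigma> i)"
    by (simp add: sum_subtractf sum_distrib_left)
  also have "\<dots> = 0" using assms by (simp add: balanced_def)
  finally show ?thesis .
qed

lemma sum_pairs:
  fixes u :: "nat \<Rightarrow> real"
  shows "(\<Sum>j\<in>{1..n}. \<Sum>i\<in>{1..<j}. u i * u j)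
         = ((\<Sum>i\<in>{1..n}. u i)\<^sup>2 - (\<Sum>i\<in>{1..n}. (u i)\<^sup>2)) / 2"
proof (induction n)
  case (Suc n)
  have "{1..<Suc n} = {1..n}" by auto
  then show ?case using Suc
    by (simp add: sum_distrib_right[symmetric] power2_eq_square field_simps)
qed simp

text \<open>The entries are pairs \<open>i < j\<close> times a time \<open>t\<close>, so a rank-one
  summand factorises, and the sum over pairs is half of the full square without its diagonal. With
  signs this gives centring, with ones the number of entries, and with products of two sign patterns
  their overlap.\<close>

lemma sum_entries:
  fixes u v :: "nat \<Rightarrow> real"
  shows "(\<Sum>(i, j, t)\<in>entries n T. u i * u j * v t)
         = (\<Sum>t\<in>{1..T}. v t) * ((\<Sum>i\<in>{1..n}. u i)\<^sup>2 - (\<Sum>i\<in>{1..n}. (u i)\<^sup>2)) / 2"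
proof -
  \<comment> \<open>Listing \<open>j\<close> first lets \<open>i\<close> range over
    \<open>{1..<j}\<close>, the form that \<open>sum_pairs\<close> handles by induction.\<close>
  have "(\<Sum>(i, j, t)\<in>entries n T. u i * u j * v t)
      = (\<Sum>(j, i, t)\<in>(SIGMA j:{1..n}. {1..<j} \<times> {1..T}). u i * u j * v t)"
    by (rule sum.reindex_bij_witness[of _ "\<lambda>(j, i, t). (i, j, t)" "\<lambda>(i, j, t). (j, i, t)"])
      (auto simp: entries_def)
  also have "\<dots> = (\<Sum>j\<in>{1..n}. \<Sum>i\<in>{1..<j}. \<Sum>t\<in>{1..T}. u i * u j * v t)"
    by (subst sum.Sigma[symmetric]) (auto simp: sum.cartesian_product)
  also have "\<dots> = (\<Sum>t\<in>{1..T}. v t) * (\<Sum>j\<in>{1..n}. \<Sum>i\<in>{1..<j}. u i * u j)"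
    by (simp add: sum_distrib_left sum_distrib_right mult_ac)
  finally show ?thesis by (simp only: sum_pairs times_divide_eq_right)
qed

section \<open>Sign coding of the model and of the objective\<close>

definition parity_sign :: "(nat \<Rightarrow> nat) \<times> (nat \<Rightarrow> nat) \<Rightarrow> nat \<times> nat \<times> nat \<Rightarrow> real" where
  "parity_sign = (\<lambda>(\<sigma>, \<tau>) (i, j, t). (-1) ^ (\<sigma> i + \<sigma> j + \<tau> t))"

lemma parity_sign_cases: "parity_sign x e = 1 \<or> parity_sign x e = -1"
  by (cases x; cases e) (simp add: parity_sign_def minus_one_power_iff)

lemma parity_sign_square: "parity_sign x e * parity_sign x e = 1"
  using parity_sign_cases[of x e] by auto

lemma abs_parity_sign: "\<bar>parity_sign x e\<bar> = 1"
  using parity_sign_cases[of x e] by auto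

text \<open>The sum factorises and its factor over the times vanishes by balance. This centring
  removes the constant terms from all mean computations below.\<close>

lemma sum_parity_sign:
  assumes "\<tau> \<in> balanced T"
  shows "(\<Sum>e\<in>entries n T. parity_sign (\<sigma>, \<tau>) e) = 0"
proof -
  have "(\<Sum>e\<in>entries n T. parity_sign (\<sigma>, \<tau>) e)
      = (\<Sum>(i, j, t)\<in>entries n T. (-1) ^ \<sigma> i * (-1) ^ \<sigma> j * (-1) ^ \<tau> t)"
    by (intro sum.cong) (auto simp: parity_sign_def power_add)
  then show ?thesis by (simp only: sum_entries sum_sign_balanced[OF assms] mult_zero_left div_0)
qed

lemma card_entries: "real (card (entries n T)) = real T * ((real n)\<^sup>2 - real n) / 2"
proof -
  have "real (card (entries n T)) = (\<Sum>(i, j, t)\<in>entries n T. 1 * 1 * 1)" by simp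
  also have "\<dots> = real T * ((real n)\<^sup>2 - real n) / 2"
    by (subst sum_entries) simp
  finally show ?thesis .
qed

text \<open>The parity condition has indicator \<open>(1 + parity_sign x e) / 2\<close>, so the
  objective is a linear statistic on all entries, and differences of objectives fall under the
  Chernoff bound.\<close>

lemma mle_objective_eq:
  "real (mle_objective n T A x)
     = (\<Sum>e\<in>entries n T. (1 + parity_sign x e) / 2 * of_bool (A e))"
proof -
  obtain \<sigma> \<tau> where x: "x = (\<sigma>, \<tau>)" by force
  have "real (mle_objective n T A x)
      = (\<Sum>e\<in>{e \<in> entries n T. parity_sign x e = 1}. of_bool (A e))"
    unfolding mle_objective_def x of_nat_sum prod.case
    by (intro sum.cong) (auto simp: parity_sign_def minus_one_power_iff split: if_splits)
  also have "\<dots> = (\<Sum>e\<in>entries n T. if parity_sign x e = 1 then of_bool (A e) else 0)"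
    by (rule sum.inter_filter[OF finite_entries])
  also have "\<dots> = (\<Sum>e\<in>entries n T. (1 + parity_sign x e) / 2 * of_bool (A e))"
    using parity_sign_cases[of x] by (intro sum.cong) fastforce+
  finally show ?thesis .
qed

lemma B_eq_parity_sign:
  assumes "\<sigma> \<in> balanced n" "\<tau> \<in> balanced T" "(i, j, t) \<in> entries n T"
  shows "B \<rho> (\<tau> t) (\<sigma> i) (\<sigma> j) = \<rho> * (1 + parity_sign (\<sigma>, \<tau>) (i, j, t) / 2)"
  using balanced_range[OF assms(1), of i] balanced_range[OF assms(1), of j]
    balanced_range[OF assms(2), of t] assms(3)
  by (auto simp: entries_def B_def parity_sign_def)

text \<open>\<open>P1\<close> is a mixture over the hidden labels, so a bound that holds uniformly
  for fixed labels passes to the mixture. The event \<open>S\<close> may itself depend on the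
  labels.\<close>

lemma prob_P1_le:
  assumes "even n" "even T"
    and le: "\<And>\<sigma> \<tau>. \<sigma> \<in> balanced n \<Longrightarrow> \<tau> \<in> balanced T \<Longrightarrow>
      measure_pmf.prob (Pi_pmf (entries n T) False
        (\<lambda>e. bernoulli_pmf (\<rho> * (1 + parity_sign (\<sigma>, \<tau>) e / 2)))) {A. (A, \<sigma>, \<tau>) \<in> S} \<le> c"
  shows "measure_pmf.prob (P1 n T \<rho>) S \<le> c"
  unfolding P1_def
proof (rule prob_bind_pmf_le, rule prob_bind_pmf_le)
  fix \<sigma> \<tau>
  assume "\<sigma> \<in> set_pmf (pmf_of_set (balanced n))" "\<tau> \<in> set_pmf (pmf_of_set (balanced T))"
  then have mem: "\<sigma> \<in> balanced n" "\<tau> \<in> balanced T"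
    using assms(1,2) by (auto simp: set_pmf_of_set finite_balanced balanced_nonempty)
  let ?M = "Pi_pmf (entries n T) False (\<lambda>(i, j, t). bernoulli_pmf (B \<rho> (\<tau> t) (\<sigma> i) (\<sigma> j)))"
  have M: "?M = Pi_pmf (entries n T) False (\<lambda>e. bernoulli_pmf (\<rho> * (1 + parity_sign (\<sigma>, \<tau>) e / 2)))"
    using B_eq_parity_sign[OF mem] by (intro Pi_pmf_cong) auto
  have "measure_pmf.prob (?M \<bind> (\<lambda>A. return_pmf (A, \<sigma>, \<tau>))) S
      = measure_pmf.prob ?M {A. (A, \<sigma>, \<tau>) \<in> S}"
    by (simp only: map_pmf_def[symmetric] measure_map_pmf vimage_def)
  then show "measure_pmf.prob (?M \<bind> (\<lambda>A. return_pmf (A, \<sigma>, \<tau>))) S \<le> c"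
    using le[OF mem] by (simp only: M)
qed

lemma parity_sign_rate:
  assumes "0 < \<rho>" "\<rho> < 2/3"
  shows "0 \<le> \<rho> * (1 + parity_sign x e / 2)" "\<rho> * (1 + parity_sign x e / 2) \<le> 1"
    "\<rho> * (1 + parity_sign x e / 2) \<le> 3/2 * \<rho>"
  using parity_sign_cases[of x e] assms by auto

section \<open>Error probability of the maximum likelihood estimator\<close>

text \<open>Half the difference of the two sign patterns takes values in -1, 0, 1, and
  \<open>D\<close> bounds from below twice the number of entries where the patterns differ. Drift
  and variance proxy are both governed by this number, so a small fixed tilt makes the drift
  win.\<close>

lemma prob_objective_le:
  assumes \<rho>: "0 < \<rho>" "\<rho> < 2/3"
    and x: "x \<in> balanced n \<times> balanced T" and y: "y \<in> balanced n \<times> balanced T"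
    and D: "D \<le> real (card (entries n T)) - (\<Sum>e\<in>entries n T. parity_sign x e * parity_sign y e)"
  shows "measure_pmf.prob (Pi_pmf (entries n T) False
           (\<lambda>e. bernoulli_pmf (\<rho> * (1 + parity_sign x e / 2))))
           {A. mle_objective n T A x \<le> mle_objective n T A y} \<le> exp (- (\<rho> * D / 64))"
proof -
  let ?E = "entries n T"
  let ?p = "\<lambda>e. \<rho> * (1 + parity_sign x e / 2)"
  define w where "w e = (parity_sign y e - parity_sign x e) / 2" for e
  define G where "G = real (card ?E) - (\<Sum>e\<in>?E. parity_sign x e * parity_sign y e)"
  have zero: "(\<Sum>e\<in>?E. parity_sign x e) = 0" "(\<Sum>e\<in>?E. parity_sign y e) = 0"
    using x y sum_parity_sign by (metis mem_Sigma_iff prod.collapse)+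
  have G: "(\<Sum>e\<in>?E. (1 - parity_sign x e * parity_sign y e)) = G"
    by (simp add: G_def sum_subtractf)
  \<comment> \<open>Since the square of a sign is 1, the mean splits into a centred part, which sums
    to zero, and the overlap deficit.\<close>
  have "(\<Sum>e\<in>?E. ?p e * w e) = (\<Sum>e\<in>?E. \<rho> / 2 * (parity_sign y e - parity_sign x e)
      - \<rho> / 4 * (1 - parity_sign x e * parity_sign y e))"
    using parity_sign_square[of x] by (intro sum.cong) (auto simp: w_def field_simps)
  also have "\<dots> = - (\<rho> * G / 4)"
    by (simp only: sum_subtractf[of "\<lambda>e. \<rho> / 2 * (parity_sign y e - parity_sign x e)"]
        sum_distrib_left[symmetric] G) (simp add: sum_subtractf zero)
  finally have mean: "(\<Sum>e\<in>?E. ?p e * w e) = - (\<rho> * G / 4)" .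
  have sq: "(w e)\<^sup>2 = (1 - parity_sign x e * parity_sign y e) / 2" for e
    using parity_sign_cases[of x e] parity_sign_cases[of y e] by (auto simp: w_def)
  have "(\<Sum>e\<in>?E. ?p e * (w e)\<^sup>2) \<le> (\<Sum>e\<in>?E. 3/2 * \<rho> * (w e)\<^sup>2)"
    using parity_sign_rate[OF \<rho>] by (intro sum_mono mult_right_mono) auto
  also have "\<dots> = 3/4 * \<rho> * G"
    by (simp add: sq sum_distrib_left[symmetric] sum_divide_distrib[symmetric] G)
  finally have var: "(\<Sum>e\<in>?E. ?p e * (w e)\<^sup>2) \<le> 3/4 * \<rho> * G" .
  have "(real (mle_objective n T A y) - real (mle_objective n T A x))
      = (\<Sum>e\<in>?E. w e * of_bool (A e))" for A
    unfolding mle_objective_eq sum_subtractf[symmetric]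
    by (intro sum.cong) (auto simp: w_def field_simps)
  then have "{A. mle_objective n T A x \<le> mle_objective n T A y}
      = {A. 0 \<le> (\<Sum>e\<in>?E. w e * of_bool (A e))}"
    by (metis (no_types, lifting) diff_ge_0_iff_ge of_nat_le_iff)
  then have "measure_pmf.prob (Pi_pmf ?E False (\<lambda>e. bernoulli_pmf (?p e)))
      {A. mle_objective n T A x \<le> mle_objective n T A y}
      = measure_pmf.prob (Pi_pmf ?E False (\<lambda>e. bernoulli_pmf (?p e)))
      {A. 0 \<le> (\<Sum>e\<in>?E. w e * of_bool (A e))}" by simp
  \<comment> \<open>With tilt 1/8 the exponent is at most \<open>- \<rho> * G / 32 + 3 * \<rho> * G
    / 256 = - 5 * \<rho> * G / 256\<close>, which is below \<open>- \<rho> * G / 64\<close> because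
    \<open>\<rho> * G\<close> is nonnegative.\<close>
  also have "\<dots> \<le> exp (1/8 * (\<Sum>e\<in>?E. ?p e * w e) + (1/8)\<^sup>2 * (\<Sum>e\<in>?E. ?p e * (w e)\<^sup>2) - 1/8 * 0)"
  proof (intro Pi_bernoulli_Chernoff finite_entries)
    show "\<bar>w e\<bar> \<le> 1" for e
      using parity_sign_cases[of x e] parity_sign_cases[of y e] by (auto simp: w_def)
  qed (use parity_sign_rate[OF \<rho>] in simp_all)
  also have "\<dots> \<le> exp (- (\<rho> * D / 64))"
  proof -
    have "0 \<le> G" unfolding G[symmetric] using sq by (intro sum_nonneg)
      (metis zero_le_power2 zero_le_divide_iff not_numeral_le_zero)
    then have "0 \<le> \<rho> * G" "\<rho> * D \<le> \<rho> * G" using \<rho> D by (simp_all add: G_def)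
    then show ?thesis using var by (simp add: mean power2_eq_square)
  qed
  finally show ?thesis .
qed

text \<open>The overlap equals \<open>b * (a\<^sup>2 - m) / 2\<close>, where \<open>a\<close> and
  \<open>b\<close> are the correlations of the vertex labels and of the time labels. Always
  \<open>\<bar>b\<bar> \<le> T\<close>, so no choice of time labels can make up for a poor
  \<open>a\<close>. As \<open>a\<close> enters squared, a global flip of the vertex labels is
  invisible, which matches the minimum in \<open>loss\<close>.\<close>

lemma parity_sign_overlap:
  assumes "\<sigma> \<in> balanced n" "\<sigma>' \<in> balanced n"
    and "4 \<le> n" "0 < \<epsilon>" "\<epsilon> \<le> 1/4" and loss: "\<epsilon> \<le> loss n \<sigma>' \<sigma>"
  shows "\<epsilon> * real T * (real n)\<^sup>2
    \<le> real (card (entries n T)) - (\<Sum>e\<in>entries n T. parity_sign (\<sigma>, \<tau>) e * parity_sign (\<sigma>', \<tau>') e)"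
proof -
  define u :: "nat \<Rightarrow> real" where "u i = (-1) ^ (\<sigma> i + \<sigma>' i)" for i
  define v :: "nat \<Rightarrow> real" where "v t = (-1) ^ (\<tau> t + \<tau>' t)" for t
  define a where "a = (\<Sum>i\<in>{1..n}. u i)"
  define b where "b = (\<Sum>t\<in>{1..T}. v t)"
  define h where "h = hamming n \<sigma>' \<sigma>"
  define h' where "h' = hamming n \<sigma>' (\<lambda>i. 1 - \<sigma> i)"
  define m where "m = real n"
  have "(u i)\<^sup>2 = 1" for i by (simp add: u_def minus_one_power_iff)
  then have u2: "(\<Sum>i\<in>{1..n}. (u i)\<^sup>2) = m" by (simp add: m_def)
  have Q: "(\<Sum>e\<in>entries n T. parity_sign (\<sigma>, \<tau>) e * parity_sign (\<sigma>', \<tau>') e) = b * (a\<^sup>2 - m) / 2"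
    unfolding a_def b_def u2[symmetric] sum_entries[symmetric]
    by (intro sum.cong) (auto simp: parity_sign_def u_def v_def power_add)
  have "\<bar>b\<bar> \<le> (\<Sum>t\<in>{1..T}. \<bar>v t\<bar>)" unfolding b_def by (rule sum_abs)
  then have b: "\<bar>b\<bar> \<le> real T" by (simp add: v_def power_abs)
  have h: "real h = (\<Sum>i\<in>{1..n}. of_bool (\<sigma>' i \<noteq> \<sigma> i))"
    by (simp add: h_def hamming_def Int_def)
  have h': "real h' = (\<Sum>i\<in>{1..n}. of_bool (\<sigma>' i \<noteq> 1 - \<sigma> i))"
    by (simp add: h'_def hamming_def Int_def)
  \<comment> \<open>Reading \<open>a\<close> through \<open>h\<close> bounds it from above, and
    through \<open>h'\<close> from below.\<close>
  have "a = (\<Sum>i\<in>{1..n}. 1 - 2 * of_bool (\<sigma>' i \<noteq> \<sigma> i))"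
    unfolding a_def u_def using balanced_range[OF assms(1)] balanced_range[OF assms(2)]
    by (intro sum.cong) fastforce+
  then have a: "a = m - 2 * real h" by (simp add: h m_def sum_subtractf sum_distrib_left)
  have "a = (\<Sum>i\<in>{1..n}. 2 * of_bool (\<sigma>' i \<noteq> 1 - \<sigma> i) - 1)"
    unfolding a_def u_def using balanced_range[OF assms(1)] balanced_range[OF assms(2)]
    by (intro sum.cong) fastforce+
  then have a': "a = 2 * real h' - m" by (simp add: h' m_def sum_subtractf sum_distrib_left)
  have m: "4 \<le> m" using \<open>4 \<le> n\<close> by (simp add: m_def)
  have "\<epsilon> * m \<le> real (min h h')"
    using loss m by (simp add: loss_def h_def h'_def m_def pos_le_divide_eq)
  then have "\<bar>a\<bar> \<le> (1 - 2 * \<epsilon>) * m" using a a' by (simp add: algebra_simps)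
  then have "a\<^sup>2 \<le> ((1 - 2 * \<epsilon>) * m)\<^sup>2" by (metis abs_ge_zero power2_abs power_mono)
  also have "\<dots> = m\<^sup>2 - 4 * \<epsilon> * (1 - \<epsilon>) * m\<^sup>2" by (simp add: power2_eq_square algebra_simps)
  also have "\<dots> \<le> m\<^sup>2 - 2 * \<epsilon> * m\<^sup>2"
  proof -
    have "2 * \<epsilon> * m\<^sup>2 * 1 \<le> 2 * \<epsilon> * m\<^sup>2 * (2 * (1 - \<epsilon>))" using assms by (intro mult_left_mono) auto
    then show ?thesis by (simp add: algebra_simps)
  qed
  finally have a2: "a\<^sup>2 \<le> m\<^sup>2 - 2 * \<epsilon> * m\<^sup>2" .
  have m2: "4 * m \<le> m\<^sup>2" using m by (simp add: power2_eq_square)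
  have e: "\<epsilon> * m\<^sup>2 \<le> 1/4 * m\<^sup>2" using assms by (intro mult_right_mono) auto
  \<comment> \<open>Both signs matter, since \<open>b\<close> may be negative. When
    \<open>a\<^sup>2 < m\<close> it suffices that
    \<open>2 * m \<le> (1 - 2 * \<epsilon>) * m\<^sup>2\<close>, which follows from
    \<open>m \<ge> 4\<close> and \<open>\<epsilon> \<le> 1/4\<close>.\<close>
  have am: "\<bar>a\<^sup>2 - m\<bar> \<le> m\<^sup>2 - m - 2 * \<epsilon> * m\<^sup>2"
    using a2 m2 e zero_le_power2[of a] unfolding abs_le_iff by linarith
  have "b * (a\<^sup>2 - m) \<le> \<bar>b\<bar> * \<bar>a\<^sup>2 - m\<bar>" by (simp only: abs_mult[symmetric] abs_ge_self)
  also have "\<dots> \<le> real T * (m\<^sup>2 - m - 2 * \<epsilon> * m\<^sup>2)" by (rule mult_mono[OF b am]) simp_all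
  also have "\<dots> = real T * (m\<^sup>2 - m) - 2 * (\<epsilon> * real T * m\<^sup>2)" by (simp add: algebra_simps)
  finally show ?thesis unfolding Q card_entries m_def[symmetric] by linarith
qed

text \<open>An error exhibits a far competitor whose objective is at least that of the true labels,
  however ties are broken; a union bound over all such competitors applies.\<close>

lemma mle_error_bound:
  assumes "even n" "even T" and \<rho>: "0 < \<rho>" "\<rho> < 2/3"
    and "4 \<le> n" and \<epsilon>: "0 < \<epsilon>" "\<epsilon> \<le> 1/4" and mle: "is_mle n T est"
  shows "measure_pmf.prob (P1 n T \<rho>) {(A, \<sigma>, \<tau>). \<epsilon> \<le> loss n (fst (est A)) \<sigma>}
         \<le> 2 ^ (n + T) * exp (- (\<epsilon> / 64 * (\<rho> * real T * (real n)\<^sup>2)))"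
proof (rule prob_P1_le[OF assms(1,2)])
  fix \<sigma> \<tau> assume mem: "\<sigma> \<in> balanced n" "\<tau> \<in> balanced T"
  let ?M = "Pi_pmf (entries n T) False (\<lambda>e. bernoulli_pmf (\<rho> * (1 + parity_sign (\<sigma>, \<tau>) e / 2)))"
  define I where "I = {y \<in> balanced n \<times> balanced T. \<epsilon> \<le> loss n (fst y) \<sigma>}"
  have "finite I" by (simp add: I_def finite_balanced)
  have "card I \<le> card (balanced n \<times> balanced T)"
    unfolding I_def by (intro card_mono) (auto simp: finite_balanced)
  also have "\<dots> \<le> 2 ^ (n + T)"
    by (simp add: card_cartesian_product power_add mult_le_mono card_balanced_le)
  finally have I: "real (card I) \<le> 2 ^ (n + T)"
    by (metis of_nat_le_iff of_nat_numeral of_nat_power)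
  \<comment> \<open>\<open>is_mle\<close> constrains the estimator only on
    \<open>observations\<close>, so the inclusion of events below holds almost surely.\<close>
  have supp: "set_pmf ?M \<subseteq> observations n T"
    by (auto simp: set_Pi_pmf finite_entries observations_def PiE_dflt_def)
  have "measure_pmf.prob ?M {A. (A, \<sigma>, \<tau>) \<in> {(A, \<sigma>, \<tau>). \<epsilon> \<le> loss n (fst (est A)) \<sigma>}}
      \<le> measure_pmf.prob ?M
          (\<Union>y\<in>I. {A. mle_objective n T A (\<sigma>, \<tau>) \<le> mle_objective n T A y})"
  proof (intro measure_pmf.finite_measure_mono_AE)
    have "est A \<in> I \<and> mle_objective n T A (\<sigma>, \<tau>) \<le> mle_objective n T A (est A)"
      if "A \<in> observations n T" "\<epsilon> \<le> loss n (fst (est A)) \<sigma>" for A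
      using mle that mem unfolding is_mle_def is_arg_max_linorder I_def by blast
    then show "AE A in ?M. A \<in> {A. (A, \<sigma>, \<tau>) \<in> {(A, \<sigma>, \<tau>). \<epsilon> \<le> loss n (fst (est A)) \<sigma>}} \<longrightarrow>
        A \<in> (\<Union>y\<in>I. {A. mle_objective n T A (\<sigma>, \<tau>) \<le> mle_objective n T A y})"
      using supp by (auto simp: AE_measure_pmf_iff)
  qed simp
  also have "\<dots> \<le> real (card I) * exp (- (\<rho> * (\<epsilon> * real T * (real n)\<^sup>2) / 64))"
  proof (intro prob_UN_le_card[OF \<open>finite I\<close>] prob_objective_le[OF \<rho>])
    fix y assume "y \<in> I"
    then show "\<epsilon> * real T * (real n)\<^sup>2 \<le> real (card (entries n T))
        - (\<Sum>e\<in>entries n T. parity_sign (\<sigma>, \<tau>) e * parity_sign y e)"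
      using parity_sign_overlap[OF mem(1) _ \<open>4 \<le> n\<close> \<epsilon>, of "fst y" T \<tau> "snd y"]
      by (auto simp: I_def)
  qed (use mem in \<open>auto simp: I_def\<close>)
  also have "\<dots> \<le> 2 ^ (n + T) * exp (- (\<rho> * (\<epsilon> * real T * (real n)\<^sup>2) / 64))"
    using I by (intro mult_right_mono) auto
  finally show "measure_pmf.prob ?M {A. (A, \<sigma>, \<tau>) \<in> {(A, \<sigma>, \<tau>). \<epsilon> \<le> loss n (fst (est A)) \<sigma>}}
      \<le> 2 ^ (n + T) * exp (- (\<epsilon> / 64 * (\<rho> * real T * (real n)\<^sup>2)))"
    by (simp add: mult_ac)
qed

section \<open>The scan test\<close>

text \<open>This is twice \<open>mle_objective\<close> minus the sum of \<open>of_bool (A e)\<close>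
  over all entries, which centres it under \<open>P0\<close> for balanced time labels.\<close>

definition scan_statistic :: "nat \<Rightarrow> nat \<Rightarrow> obs \<Rightarrow> (nat \<Rightarrow> nat) \<times> (nat \<Rightarrow> nat) \<Rightarrow> real" where
  "scan_statistic n T A x = (\<Sum>e\<in>entries n T. parity_sign x e * of_bool (A e))"

text \<open>It suffices to look at the true labels: their statistic has mean
  \<open>\<rho> * card / 2\<close>, twice the threshold. Negated weights turn the lower tail into an
  upper one.\<close>

lemma scan_miss_bound:
  assumes "even n" "even T" and \<rho>: "0 < \<rho>" "\<rho> < 2/3"
  shows "measure_pmf.prob (P1 n T \<rho>) {(A, \<sigma>, \<tau>). \<forall>x \<in> balanced n \<times> balanced T.
           scan_statistic n T A x < \<rho> * real (card (entries n T)) / 4}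
         \<le> exp (- (\<rho> * real (card (entries n T)) / 64))" (is "measure_pmf.prob _ ?S \<le> _")
proof (rule prob_P1_le[OF assms(1,2)])
  fix \<sigma> \<tau> assume mem: "\<sigma> \<in> balanced n" "\<tau> \<in> balanced T"
  let ?E = "entries n T"
  let ?x = "(\<sigma>, \<tau>)"
  let ?p = "\<lambda>e. \<rho> * (1 + parity_sign ?x e / 2)"
  let ?M = "Pi_pmf ?E False (\<lambda>e. bernoulli_pmf (?p e))"
  let ?w = "\<lambda>e. - parity_sign ?x e"
  define N where "N = \<rho> * real (card ?E)"
  have zero: "(\<Sum>e\<in>?E. parity_sign ?x e) = 0" by (rule sum_parity_sign[OF mem(2)])
  have "(\<Sum>e\<in>?E. ?p e * ?w e) = (\<Sum>e\<in>?E. - \<rho> * parity_sign ?x e - \<rho> / 2)"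
    using parity_sign_square[of ?x] by (intro sum.cong) (auto simp: algebra_simps)
  also have "\<dots> = - (N / 2)"
    by (simp only: sum_subtractf sum_distrib_left[symmetric] zero) (simp add: N_def)
  finally have mean: "(\<Sum>e\<in>?E. ?p e * ?w e) = - (N / 2)" .
  have "(\<Sum>e\<in>?E. ?p e * (?w e)\<^sup>2) = (\<Sum>e\<in>?E. \<rho> + \<rho> / 2 * parity_sign ?x e)"
    using parity_sign_square[of ?x] by (intro sum.cong) (auto simp: power2_eq_square algebra_simps)
  also have "\<dots> = N"
    by (simp only: sum.distrib sum_distrib_left[symmetric] zero) (simp add: N_def)
  finally have var: "(\<Sum>e\<in>?E. ?p e * (?w e)\<^sup>2) = N" .
  have "measure_pmf.prob ?M {A. (A, \<sigma>, \<tau>) \<in> ?S}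
      \<le> measure_pmf.prob ?M {A. - (N / 4) \<le> (\<Sum>e\<in>?E. ?w e * of_bool (A e))}"
    using mem by (intro measure_pmf.finite_measure_mono)
      (force simp: scan_statistic_def sum_negf N_def)+
  \<comment> \<open>The exponent is \<open>- N / 16 + N / 64 + N / 32 = - N / 64\<close>.\<close>
  also have "\<dots> \<le> exp (1/8 * (\<Sum>e\<in>?E. ?p e * ?w e) + (1/8)\<^sup>2 * (\<Sum>e\<in>?E. ?p e * (?w e)\<^sup>2)
      - 1/8 * (- (N / 4)))"
    using parity_sign_rate[OF \<rho>, of ?x]
    by (intro Pi_bernoulli_Chernoff finite_entries) (simp_all add: abs_parity_sign)
  also have "\<dots> = exp (- (N / 64))" unfolding mean var by (simp add: power2_eq_square)
  finally show "measure_pmf.prob ?M {A. (A, \<sigma>, \<tau>) \<in> ?S}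
      \<le> exp (- (\<rho> * real (card ?E) / 64))"
    by (simp only: N_def)
qed

text \<open>Under \<open>P0\<close> each fixed pattern has mean zero and variance proxy
  \<open>N\<close>, so tilt 1/8 gives \<open>N / 64 - N / 32 = - N / 64\<close>, the same rate as
  for a miss; the factor in front comes from the union over patterns.\<close>

lemma scan_false_alarm_bound:
  assumes \<rho>: "0 < \<rho>" "\<rho> < 2/3"
  shows "measure_pmf.prob (P0 n T \<rho>) {A. \<exists>x \<in> balanced n \<times> balanced T.
           \<rho> * real (card (entries n T)) / 4 \<le> scan_statistic n T A x}
         \<le> 2 ^ (n + T) * exp (- (\<rho> * real (card (entries n T)) / 64))"
proof -
  let ?E = "entries n T"
  let ?I = "balanced n \<times> balanced T"
  define N where "N = \<rho> * real (card ?E)"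
  have single: "measure_pmf.prob (P0 n T \<rho>) {A. N / 4 \<le> scan_statistic n T A x} \<le> exp (- (N / 64))"
    if "x \<in> ?I" for x
  proof -
    have zero: "(\<Sum>e\<in>?E. parity_sign x e) = 0"
      using that sum_parity_sign by (metis mem_Sigma_iff prod.collapse)
    have "measure_pmf.prob (P0 n T \<rho>) {A. N / 4 \<le> scan_statistic n T A x}
        \<le> exp (1/8 * (\<Sum>e\<in>?E. \<rho> * parity_sign x e) + (1/8)\<^sup>2 * (\<Sum>e\<in>?E. \<rho> * (parity_sign x e)\<^sup>2)
          - 1/8 * (N / 4))"
      unfolding P0_def scan_statistic_def using \<rho>
      by (intro Pi_bernoulli_Chernoff finite_entries) (simp_all add: abs_parity_sign)
    also have "\<dots> = exp (- (N / 64))"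
      unfolding power2_eq_square parity_sign_square sum_distrib_left[symmetric] zero
      by (simp add: N_def)
    finally show ?thesis .
  qed
  have "{A. \<exists>x \<in> ?I. N / 4 \<le> scan_statistic n T A x}
      = (\<Union>x\<in>?I. {A. N / 4 \<le> scan_statistic n T A x})" by auto
  then have "measure_pmf.prob (P0 n T \<rho>) {A. \<exists>x \<in> ?I. N / 4 \<le> scan_statistic n T A x}
      \<le> real (card ?I) * exp (- (N / 64))"
    using prob_UN_le_card[OF _ single, of ?I] by (simp add: finite_balanced)
  also have "card ?I \<le> 2 ^ (n + T)"
    by (simp add: card_cartesian_product power_add mult_le_mono card_balanced_le)
  then have "real (card ?I) \<le> 2 ^ (n + T)"
    by (metis of_nat_le_iff of_nat_numeral of_nat_power)
  then have "real (card ?I) * exp (- (N / 64)) \<le> 2 ^ (n + T) * exp (- (N / 64))"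
    by (intro mult_right_mono) auto
  finally show ?thesis by (simp only: N_def)
qed

section \<open>Limits along even sizes\<close>

lemma eventually_even_at_top:
  "eventually P even_at_top \<longleftrightarrow> (\<forall>\<^sub>F n in at_top. even n \<longrightarrow> P n)"
  by (simp add: even_at_top_def eventually_inf_principal)

lemma eventually_even_at_top_ge: "\<forall>\<^sub>F n in even_at_top. m \<le> n \<and> even n"
  unfolding eventually_even_at_top using eventually_ge_at_top[of m] by eventually_elim simp

text \<open>The exponent is spent in thirds: one absorbs \<open>n\<close>, as
  \<open>n * T * \<rho>\<close> eventually exceeds \<open>3 / c\<close>; one absorbs
  \<open>T\<close>, as \<open>1 / \<rho>\<close> is eventually at most
  \<open>c / 3 * n\<^sup>2\<close>; the last still exceeds \<open>c / 3 * (n * T * \<rho>)\<close>,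
  which diverges.\<close>

lemma union_bound_tendsto_0:
  fixes T :: "nat \<Rightarrow> nat" and \<rho> :: "nat \<Rightarrow> real"
  assumes pos: "\<forall>\<^sub>F n in even_at_top. 0 < \<rho> n"
    and dense: "(\<lambda>n. inverse (\<rho> n)) \<in> o[even_at_top](\<lambda>n. (real n)\<^sup>2)"
    and lim: "filterlim (\<lambda>n. real n * real (T n) * \<rho> n) at_top even_at_top"
    and c: "0 < c"
  shows "((\<lambda>n. 2 ^ (n + T n) * exp (- (c * (\<rho> n * real (T n) * (real n)\<^sup>2)))) \<longlongrightarrow> 0) even_at_top"
proof (rule tendsto_sandwich[where f = "\<lambda>_. 0"])
  have "filterlim (\<lambda>n. c / 3 * (real n * real (T n) * \<rho> n)) at_top even_at_top"
    using c by (intro filterlim_tendsto_pos_mult_at_top[OF tendsto_const _ lim]) simp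
  then show "((\<lambda>n. exp (- (c / 3 * (real n * real (T n) * \<rho> n)))) \<longlongrightarrow> 0) even_at_top"
    by (intro filterlim_compose[OF exp_at_bot] filterlim_compose[OF filterlim_uminus_at_bot_at_top])
  have "\<forall>\<^sub>F n in even_at_top. norm (inverse (\<rho> n)) \<le> c / 3 * norm ((real n)\<^sup>2)"
    using c by (intro landau_o.smallD[OF dense]) simp
  moreover have "\<forall>\<^sub>F n in even_at_top. 3 / c \<le> real n * real (T n) * \<rho> n"
    using lim by (simp add: filterlim_at_top)
  ultimately show "\<forall>\<^sub>F n in even_at_top. 2 ^ (n + T n) * exp (- (c * (\<rho> n * real (T n) * (real n)\<^sup>2)))
      \<le> exp (- (c / 3 * (real n * real (T n) * \<rho> n)))"
    using pos eventually_even_at_top_ge[of 1]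
  proof eventually_elim
    case (elim n)
    define m where "m = real n"
    define t where "t = real (T n)"
    define r where "r = \<rho> n"
    have pos: "1 \<le> m" "0 \<le> t" "0 < r" using elim by (auto simp: m_def t_def r_def)
    have "1 / r \<le> c / 3 * m\<^sup>2" using elim by (simp add: m_def r_def inverse_eq_divide)
    then have "1 \<le> c / 3 * m\<^sup>2 * r" using pos by (simp add: pos_divide_le_eq)
    then have "t * 1 \<le> t * (c / 3 * m\<^sup>2 * r)" using pos by (intro mult_left_mono) auto
    then have t: "t \<le> c / 3 * (r * t * m\<^sup>2)" by (simp add: mult_ac)
    have "3 / c \<le> m * t * r" using elim by (simp add: m_def t_def r_def)
    then have "1 \<le> c / 3 * (m * t * r)" using c by (simp add: pos_divide_le_eq field_simps)
    then have "m * 1 \<le> m * (c / 3 * (m * t * r))" using pos by (intro mult_left_mono) auto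
    then have m: "m \<le> c / 3 * (r * t * m\<^sup>2)" by (simp add: power2_eq_square mult_ac)
    have "1 * (c / 3 * (m * t * r)) \<le> m * (c / 3 * (m * t * r))"
      using pos c by (intro mult_right_mono) auto
    then have l: "c / 3 * (m * t * r) \<le> c / 3 * (r * t * m\<^sup>2)"
      by (simp add: power2_eq_square mult_ac)
    have "(2::real) ^ (n + T n) \<le> exp 1 ^ (n + T n)"
      using exp_ge_add_one_self[of 1] by (intro power_mono) auto
    also have "\<dots> = exp (m + t)" by (simp add: m_def t_def exp_of_nat_mult[symmetric])
    finally have "2 ^ (n + T n) * exp (- (c * (r * t * m\<^sup>2)))
        \<le> exp (m + t) * exp (- (c * (r * t * m\<^sup>2)))" by (intro mult_right_mono) auto
    also have "\<dots> = exp (m + t - c * (r * t * m\<^sup>2))" by (simp add: exp_add[symmetric])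
    also have "\<dots> \<le> exp (- (c / 3 * (m * t * r)))" using t m l by simp
    finally show ?case by (simp only: m_def t_def r_def)
  qed
qed simp_all

section \<open>Consistency, recoverability and distinguishability\<close>

text \<open>Consistency is stated for every maximizer; recoverability also needs that one exists.
  The candidate set is finite and nonempty, so a maximizer can be chosen for each
  observation.\<close>

lemma ex_mle:
  assumes "even n" "even T"
  shows "\<exists>est. is_mle n T est"
proof -
  let ?C = "balanced n \<times> balanced T"
  have C: "finite ?C" "?C \<noteq> {}" using assms by (simp_all add: finite_balanced balanced_nonempty)
  have "\<exists>x. is_arg_max (mle_objective n T A) (\<lambda>x. x \<in> ?C) x" for A
  proof -
    have "Max (mle_objective n T A ` ?C) \<in> mle_objective n T A ` ?C"
      using C by (intro Max_in) auto
    then obtain x where x: "x \<in> ?C" "Max (mle_objective n T A ` ?C) = mle_objective n T A x"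
      by (rule imageE)
    have "mle_objective n T A y \<le> mle_objective n T A x" if "y \<in> ?C" for y
      unfolding x(2)[symmetric] using that C by (intro Max_ge) auto
    then show ?thesis using x(1) unfolding is_arg_max_linorder by blast
  qed
  then have "\<exists>est. \<forall>A. is_arg_max (mle_objective n T A) (\<lambda>x. x \<in> ?C) (est A)"
    by (intro choice allI)
  then show ?thesis unfolding is_mle_def by blast
qed

theorem theorem4p2:
  fixes T :: "nat \<Rightarrow> nat" and \<rho> :: "nat \<Rightarrow> real"
  assumes "\<And>n. n > 0 \<Longrightarrow> even n \<Longrightarrow> T n > 0 \<and> even (T n)"
    and "\<And>n. n > 0 \<Longrightarrow> even n \<Longrightarrow> 0 < \<rho> n \<and> \<rho> n < 2/3"
    and "filterlim T at_top even_at_top"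
    and "(\<rho> \<longlongrightarrow> 0) even_at_top"
    and "(\<lambda>n. inverse (\<rho> n)) \<in> o[even_at_top](\<lambda>n. (real n)\<^sup>2)"
    and "filterlim (\<lambda>n. real n * real (T n) * \<rho> n) at_top even_at_top"
  shows "(\<forall>mle. (\<forall>n>0. even n \<longrightarrow> is_mle n (T n) (mle n)) \<longrightarrow>
            (\<forall>\<epsilon>>0. ((\<lambda>n. measure_pmf.prob (P1 n (T n) (\<rho> n))
                        {(A, \<sigma>, \<tau>). loss n (fst (mle n A)) \<sigma> \<ge> \<epsilon>}) \<longlongrightarrow> 0) even_at_top))
         \<and> recoverable T \<rho> \<and> distinguishable T \<rho>"
proof (intro conjI)
  have "\<forall>\<^sub>F n in even_at_top. 0 < \<rho> n"
    using eventually_even_at_top_ge[of 1] by eventually_elim (use assms(2) in auto)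
  note vanish = union_bound_tendsto_0[OF this assms(5,6)]
  show consistency: "\<forall>mle. (\<forall>n>0. even n \<longrightarrow> is_mle n (T n) (mle n)) \<longrightarrow>
            (\<forall>\<epsilon>>0. ((\<lambda>n. measure_pmf.prob (P1 n (T n) (\<rho> n))
                        {(A, \<sigma>, \<tau>). loss n (fst (mle n A)) \<sigma> \<ge> \<epsilon>}) \<longlongrightarrow> 0) even_at_top)"
  proof (intro allI impI)
    fix mle and \<epsilon> :: real
    assume mle: "\<forall>n>0. even n \<longrightarrow> is_mle n (T n) (mle n)" and "0 < \<epsilon>"
    \<comment> \<open>The overlap bound covers levels up to 1/4; lowering the level only enlarges
      the error event.\<close>
    define \<delta> where "\<delta> = min \<epsilon> (1/4)"
    have \<delta>: "0 < \<delta>" "\<delta> \<le> 1/4" "\<delta> \<le> \<epsilon>" using \<open>0 < \<epsilon>\<close> by (auto simp: \<delta>_def)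
    show "((\<lambda>n. measure_pmf.prob (P1 n (T n) (\<rho> n))
            {(A, \<sigma>, \<tau>). loss n (fst (mle n A)) \<sigma> \<ge> \<epsilon>}) \<longlongrightarrow> 0) even_at_top"
    proof (rule tendsto_sandwich[where f = "\<lambda>_. 0"])
      show "((\<lambda>n. 2 ^ (n + T n) * exp (- (\<delta> / 64 * (\<rho> n * real (T n) * (real n)\<^sup>2)))) \<longlongrightarrow> 0) even_at_top"
        using \<delta> by (intro vanish) simp
      show "\<forall>\<^sub>F n in even_at_top. measure_pmf.prob (P1 n (T n) (\<rho> n))
            {(A, \<sigma>, \<tau>). loss n (fst (mle n A)) \<sigma> \<ge> \<epsilon>}
          \<le> 2 ^ (n + T n) * exp (- (\<delta> / 64 * (\<rho> n * real (T n) * (real n)\<^sup>2)))"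
        using eventually_even_at_top_ge[of 4]
      proof eventually_elim
        case (elim n)
        then have n: "0 < n" "even n" "4 \<le> n" by auto
        have "measure_pmf.prob (P1 n (T n) (\<rho> n)) {(A, \<sigma>, \<tau>). loss n (fst (mle n A)) \<sigma> \<ge> \<epsilon>}
            \<le> measure_pmf.prob (P1 n (T n) (\<rho> n)) {(A, \<sigma>, \<tau>). loss n (fst (mle n A)) \<sigma> \<ge> \<delta>}"
          using \<delta> by (intro measure_pmf.finite_measure_mono) auto
        also have "\<dots> \<le> 2 ^ (n + T n) * exp (- (\<delta> / 64 * (\<rho> n * real (T n) * (real n)\<^sup>2)))"
          using n \<delta> assms(1,2)[of n] mle by (intro mle_error_bound) auto
        finally show ?case .
      qed
    qed simp_all
  qed
  show "recoverable T \<rho>"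
  proof -
    have "\<forall>n. \<exists>est. 0 < n \<longrightarrow> even n \<longrightarrow> is_mle n (T n) est" using ex_mle assms(1) by blast
    then obtain mle where mle: "\<forall>n>0. even n \<longrightarrow> is_mle n (T n) (mle n)" by metis
    then have "\<forall>n>0. even n \<longrightarrow> (\<forall>A \<in> observations n (T n). fst (mle n A) \<in> balanced n)"
      unfolding is_mle_def is_arg_max_def by (metis mem_Sigma_iff prod.collapse)
    moreover have "consistent T \<rho> (\<lambda>n A. fst (mle n A))"
      unfolding consistent_def using consistency mle by blast
    ultimately show ?thesis
      unfolding recoverable_def by (intro exI[of _ "\<lambda>n A. fst (mle n A)"]) simp
  qed
  show "distinguishable T \<rho>"
  proof -
    define N where "N n = \<rho> n * real (card (entries n (T n)))" for n
    define \<psi> :: "nat \<Rightarrow> obs \<Rightarrow> nat" where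
      "\<psi> n A = of_bool (\<exists>x \<in> balanced n \<times> balanced (T n). N n / 4 \<le> scan_statistic n (T n) A x)"
      for n A
    have "((\<lambda>n. measure_pmf.prob (P1 n (T n) (\<rho> n)) {(A, \<sigma>, \<tau>). \<psi> n A = 0}
        + measure_pmf.prob (P0 n (T n) (\<rho> n)) {A. \<psi> n A = 1}) \<longlongrightarrow> 0) even_at_top"
    proof (rule tendsto_sandwich[where f = "\<lambda>_. 0"])
      \<comment> \<open>For \<open>n \<ge> 2\<close> there are at least
        \<open>T * n\<^sup>2 / 4\<close> entries, so the rate 1/64 per entry becomes 1/256.\<close>
      let ?b = "\<lambda>n. 2 ^ (n + T n) * exp (- (1/256 * (\<rho> n * real (T n) * (real n)\<^sup>2)))"
      show "((\<lambda>n. 2 * ?b n) \<longlongrightarrow> 0) even_at_top"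
        by (intro tendsto_mult_right_zero vanish) simp
      show "\<forall>\<^sub>F n in even_at_top. measure_pmf.prob (P1 n (T n) (\<rho> n)) {(A, \<sigma>, \<tau>). \<psi> n A = 0}
          + measure_pmf.prob (P0 n (T n) (\<rho> n)) {A. \<psi> n A = 1} \<le> 2 * ?b n"
        using eventually_even_at_top_ge[of 2]
      proof eventually_elim
        case (elim n)
        then have n: "2 \<le> n" "0 < n" "even n" by auto
        note n' = assms(1)[OF n(2,3)] assms(2)[OF n(2,3)]
        have "2 * real n \<le> (real n)\<^sup>2" using n by (simp add: power2_eq_square)
        then have "real (T n) * ((real n)\<^sup>2 / 4) \<le> real (T n) * (((real n)\<^sup>2 - real n) / 2)"
          by (intro mult_left_mono) auto
        then have "real (T n) * ((real n)\<^sup>2 / 4) \<le> real (card (entries n (T n)))"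
          by (simp add: card_entries)
        then have "\<rho> n * (real (T n) * ((real n)\<^sup>2 / 4)) \<le> N n"
          unfolding N_def using n' by (intro mult_left_mono) auto
        then have N: "exp (- (N n / 64)) \<le> exp (- (1/256 * (\<rho> n * real (T n) * (real n)\<^sup>2)))"
          by simp
        have "measure_pmf.prob (P1 n (T n) (\<rho> n)) {(A, \<sigma>, \<tau>). \<psi> n A = 0} \<le> exp (- (N n / 64))"
          using scan_miss_bound[of n "T n" "\<rho> n"] n n' by (simp add: \<psi>_def N_def not_le)
        \<comment> \<open>The factor is inserted only so that both error probabilities share the
          bound \<open>?b\<close>.\<close>
        also have "\<dots> \<le> 2 ^ (n + T n) * exp (- (N n / 64))"
          by (simp add: mult_le_cancel_right1)
        also have "\<dots> \<le> ?b n" using N by (intro mult_left_mono) auto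
        finally have miss: "measure_pmf.prob (P1 n (T n) (\<rho> n)) {(A, \<sigma>, \<tau>). \<psi> n A = 0} \<le> ?b n" .
        have "measure_pmf.prob (P0 n (T n) (\<rho> n)) {A. \<psi> n A = 1} \<le> 2 ^ (n + T n) * exp (- (N n / 64))"
          using scan_false_alarm_bound[of "\<rho> n" n "T n"] n' by (simp add: \<psi>_def N_def)
        also have "\<dots> \<le> ?b n" using N by (intro mult_left_mono) auto
        finally show ?case using miss by linarith
      qed
    qed simp_all
    then show ?thesis
      unfolding distinguishable_def by (intro exI[of _ \<psi>]) (auto simp: \<psi>_def)
  qed
qed

end
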